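(* Let $k\ge 2$ and $a_0$ be integers with $2\le a_0<k$ and $\gcd(a_0,k)=1$, and let $b_0\in\{0,\dots,k-1\}$. Define $$a^{(0)}=k,\quad a^{(1)}=a_0,\quad a^{(n)}=\delta_{a^{(n-1)}}\bigl(a^{(n-2)}\bigr)\quad(n\ge 2),$$ the recursion being continued until the value $1$ is reached, and let $r$ be the unique index with $a^{(r)}=1$. Define $$b^{(1)}=b_0,\qquad b^{(n)}=a^{(n-1)}-\delta_{a^{(n-1)}}\bigl(b^{(n-1)}\bigr)\quad (2\le n\le r).$$ Then the unique solution $x\in\{0,\dots,k-1\}$ of $\delta_k(a_0x)=b_0$ is $$x=\delta_k\!\left(k\sum_{j=0}^{r-1}\frac{b^{(j+1)}}{a^{(j)}a^{(j+1)}}\right).$$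
   Context: For an integer $k\ge 2$ and $x\in\mathbb{Z}$, $\delta_k(x)=x-k\lfloor x/k\rfloor\in\{0,\dots,k-1\}$ is the canonical remainder of $x$ modulo $k$. The statement includes that the rational number $k\sum_{j=0}^{r-1} b^{(j+1)}/(a^{(j)}a^{(j+1)})$ to which $\delta_k$ is applied is an integer. *)

theory Defs
  imports Complex_Main
begin

definition delta :: "int \<Rightarrow> int \<Rightarrow> int" where
  "delta k x = x - k * \<lfloor>(of_int x :: rat) / of_int k\<rfloor>"

text \<open>The recursion stops as soon as the value 1 is reached; the total function below is
  padded with 0 from there on.  Without the padding, the convention \<open>x / 0 = 0\<close> would give
  \<open>delta 0 x = x\<close>, so that the sequence would continue \<open>1, 0, 1, 0, \<dots>\<close> and the
  index with value 1 would not be unique.\<close>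

fun aseq :: "int \<Rightarrow> int \<Rightarrow> nat \<Rightarrow> int" where
  "aseq k a0 0 = k"
| "aseq k a0 (Suc 0) = a0"
| "aseq k a0 (Suc (Suc n)) =
     (if aseq k a0 (Suc n) \<le> 1 then 0 else delta (aseq k a0 (Suc n)) (aseq k a0 n))"

text \<open>Indexed from 1; the value at 0 is a dummy.  Only the indices up to the one at which
  \<^const>\<open>aseq\<close> reaches 1 are meaningful.\<close>

fun bseq :: "int \<Rightarrow> int \<Rightarrow> int \<Rightarrow> nat \<Rightarrow> int" where
  "bseq k a0 b0 0 = 0"
| "bseq k a0 b0 (Suc 0) = b0"
| "bseq k a0 b0 (Suc (Suc n)) =
     aseq k a0 (Suc n) - delta (aseq k a0 (Suc n)) (bseq k a0 b0 (Suc n))"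

end

theory Submission
  imports Defs "HOL-Number_Theory.Cong"
begin

text \<open>The formula is the Euclidean algorithm for \<open>k\<close> and \<open>a\<^sub>0\<close>, unrolled.  Write \<open>a i\<close>, \<open>b i\<close> for the
  two sequences.  To solve \<open>a 1 * x = b 1\<close> modulo \<open>a 0\<close>, put \<open>a 1 * x = b 1 + a 0 * y\<close>.
  Reducing modulo \<open>a 1\<close>, the number \<open>y\<close> has to satisfy \<open>a 0 * y = - b 1\<close> modulo \<open>a 1\<close>, and since
  \<open>a 2\<close> and \<open>b 2\<close> are representatives of \<open>a 0\<close> and \<open>- b 1\<close>, this reads \<open>a 2 * y = b 2\<close> modulo \<open>a 1\<close>:
  the same problem, one step further along.  Conversely, any integer solution \<open>y\<close> of the smaller
  problem gives the integer solution \<open>x = (b 1 + a 0 * y) / a 1\<close> of the larger one.  Dividing by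
  \<open>a 0\<close> turns this into \<open>x / a 0 = b 1 / (a 0 * a 1) + y / a 1\<close>, so that iterating it down to the
  trivial problem modulo \<open>1\<close> yields the sum; this is \<open>euclidean_sum_solves_congruence\<close>, which also
  delivers integrality.

  What remains is that the remainders reach 1 exactly once, which is where the coprimality of
  \<open>a\<^sub>0\<close> and \<open>k\<close> enters (\<open>ex1_aseq_eq_1\<close>), and that \<open>a\<^sub>0\<close> can be cancelled modulo \<open>k\<close>, so that
  the solution found is the only one.\<close>

lemma delta_eq_mod: "delta k x = x mod k"
  by (simp add: delta_def floor_divide_of_int_eq minus_mult_div_eq_mod)

text \<open>Only the congruence classes of the sequence entries matter in the descent, so the canonical
  choice of remainders is replaced here by congruences.\<close>

lemma euclidean_sum_solves_congruence:
  fixes a b :: "nat \<Rightarrow> int"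
  assumes "a (Suc r) = 1"
    and "\<And>i. i \<le> r \<Longrightarrow> a i \<noteq> 0"
    and "\<And>i. i < r \<Longrightarrow> [a (i + 2) = a i] (mod a (i + 1))"
    and "\<And>i. i < r \<Longrightarrow> [b (i + 2) = - b (i + 1)] (mod a (i + 1))"
  shows "\<exists>s. (of_int s :: 'a :: field_char_0) =
      of_int (a 0) * (\<Sum>j<Suc r. of_int (b (j + 1)) / (of_int (a j) * of_int (a (j + 1)))) \<and>
    [a 1 * s = b 1] (mod a 0)"
  using assms
proof (induction r arbitrary: a b)
  case 0
  then show ?case
    by (intro exI[of _ "b 1"]) auto
next
  case (Suc r)
  let ?f = "\<lambda>j. of_int (b (j + 1)) / (of_int (a j) * of_int (a (j + 1))) :: 'a"
  have "\<exists>y. (of_int y :: 'a) = of_int (a (Suc 0)) * (\<Sum>j<Suc r. ?f (Suc j)) \<and>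
      [a (Suc 1) * y = b (Suc 1)] (mod a (Suc 0))"
    using Suc.IH[of "\<lambda>i. a (Suc i)" "\<lambda>i. b (Suc i)"] Suc.prems(1,2)
      Suc.prems(3)[of "Suc _"] Suc.prems(4)[of "Suc _"] by simp
  then obtain y where y: "(of_int y :: 'a) = of_int (a 1) * (\<Sum>j<Suc r. ?f (Suc j))"
      "[a 2 * y = b 2] (mod a 1)"
    by (auto simp: numeral_2_eq_2)
  have nz: "a 0 \<noteq> 0" "a 1 \<noteq> 0"
    using Suc.prems(2)[of 0] Suc.prems(2)[of 1] by simp_all
  have "[a 0 * y = a 2 * y] (mod a 1)"
    using Suc.prems(3)[of 0] by (intro cong_mult) (simp_all add: cong_sym_eq numeral_2_eq_2)
  also have "[a 2 * y = b 2] (mod a 1)"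
    by (rule y)
  also have "[b 2 = - b 1] (mod a 1)"
    using Suc.prems(4)[of 0] by (simp add: numeral_2_eq_2)
  finally have "a 1 dvd b 1 + a 0 * y"
    by (simp add: cong_iff_dvd_diff add.commute)
  then obtain x where x: "b 1 + a 0 * y = a 1 * x" ..
  have "[a 1 * x = b 1] (mod a 0)"
    unfolding cong_iff_dvd_diff x[symmetric] by simp
  moreover have "(of_int x :: 'a) = of_int (a 0) * (\<Sum>j<Suc (Suc r). ?f j)"
  proof -
    have "of_int (b 1) + of_int (a 0) * of_int y = (of_int (a 1) * of_int x :: 'a)"
      using arg_cong[OF x, of "of_int :: int \<Rightarrow> 'a"] by simp
    then have "(of_int x :: 'a) = (of_int (b 1) + of_int (a 0) * of_int y) / of_int (a 1)"
      using nz by simp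
    also have "\<dots> = of_int (a 0) * (?f 0 + (\<Sum>j<Suc r. ?f (Suc j)))"
      unfolding y(1) using nz by (simp add: field_simps del: sum.lessThan_Suc)
    also have "?f 0 + (\<Sum>j<Suc r. ?f (Suc j)) = (\<Sum>j<Suc (Suc r). ?f j)"
      by (rule sum.lessThan_Suc_shift[symmetric])
    finally show ?thesis .
  qed
  ultimately show ?case
    by blast
qed

text \<open>An entry at most 1 makes the recursion append 0, which is again at most 1.  The index 0 has to
  be excluded because the recursion does not test the entry there.\<close>

lemma aseq_eq_0_after_le_1:
  assumes "0 < i" "i < j" "aseq k a0 i \<le> 1"
  shows "aseq k a0 j = 0"
proof -
  obtain m where i: "i = Suc m"
    using assms(1) gr0_implies_Suc by blast
  have "aseq k a0 (Suc (i + n)) = 0" for n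
    by (induction n) (use assms(3) in \<open>simp_all add: i\<close>)
  then show ?thesis
    using less_imp_Suc_add[OF assms(2)] by blast
qed

lemma aseq_ge_2_before_1:
  assumes "2 \<le> k" "aseq k a0 r = 1" "i < r"
  shows "2 \<le> aseq k a0 i"
  using assms aseq_eq_0_after_le_1[of i r k a0] by (cases "i = 0") force+

lemma aseq_eq_1_unique:
  assumes "2 \<le> k" "aseq k a0 r = 1" "aseq k a0 r' = 1"
  shows "r = r'"
  using aseq_ge_2_before_1[OF assms(1,2), of r'] aseq_ge_2_before_1[OF assms(1,3), of r] assms
  by (cases r r' rule: linorder_cases) auto

text \<open>Consecutive entries stay coprime, so the descent cannot pass from an entry at least 2 to the
  remainder 0; if it never met 1 either, it would be an infinite strict descent.\<close>

lemma ex1_aseq_eq_1: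
  assumes "2 \<le> k" "2 \<le> a0" "a0 < k" "coprime a0 k"
  shows "\<exists>!r. aseq k a0 r = 1"
proof -
  have "\<exists>r. aseq k a0 r = 1"
  proof (rule ccontr)
    assume "\<nexists>r. aseq k a0 r = 1"
    then have ne: "aseq k a0 r \<noteq> 1" for r
      by blast
    have desc: "2 \<le> aseq k a0 (Suc n) \<and> aseq k a0 (Suc n) < aseq k a0 n \<and>
        coprime (aseq k a0 (Suc n)) (aseq k a0 n)" for n
    proof (induction n)
      case 0
      then show ?case
        using assms by simp
    next
      case (Suc n)
      let ?u = "aseq k a0 n" and ?v = "aseq k a0 (Suc n)"
      have w: "aseq k a0 (Suc (Suc n)) = ?u mod ?v"
        using Suc by (simp add: delta_eq_mod)
      have "coprime (?u mod ?v) ?v"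
        using Suc by (simp add: coprime_commute)
      moreover have "?u mod ?v \<noteq> 0"
        using calculation Suc by auto
      moreover have "0 \<le> ?u mod ?v" "?u mod ?v < ?v"
        using Suc by simp_all
      moreover have "?u mod ?v \<noteq> 1"
        using ne[of "Suc (Suc n)"] w by simp
      ultimately show ?case
        unfolding w by linarith
    qed
    have "aseq k a0 n \<le> k - int n" for n
    proof (induction n)
      case (Suc n)
      then show ?case
        using desc[of n] by linarith
    qed simp
    from this[of "Suc (nat k)"] desc[of "nat k"] assms(1) show False
      by linarith
  qed
  then show ?thesis
    using aseq_eq_1_unique[OF assms(1)] by blast
qed

theorem theorem3p2:
  fixes k a0 b0 :: int
  assumes "2 \<le> k" and "2 \<le> a0" and "a0 < k" and "gcd a0 k = 1" and "b0 \<in> {0..k - 1}"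
  shows "(\<exists>!r. aseq k a0 r = 1) \<and>
    (\<exists>!x. x \<in> {0..k - 1} \<and> delta k (a0 * x) = b0) \<and>
    (\<forall>r. aseq k a0 r = 1 \<longrightarrow>
      (\<exists>s::int.
        (of_int s :: rat) = of_int k *
          (\<Sum>j<r. of_int (bseq k a0 b0 (j + 1)) / (of_int (aseq k a0 j) * of_int (aseq k a0 (j + 1)))) \<and>
        (\<forall>x\<in>{0..k - 1}. delta k (a0 * x) = b0 \<longleftrightarrow> x = delta k s)))"
proof -
  have cop: "coprime a0 k"
    using assms(4) by (simp add: coprime_iff_gcd_eq_1)
  have ex1: "\<exists>!r. aseq k a0 r = 1"
    using assms(1-3) cop by (rule ex1_aseq_eq_1)
  have main: "\<exists>s. (of_int s :: rat) = of_int k *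
        (\<Sum>j<r. of_int (bseq k a0 b0 (j + 1)) / (of_int (aseq k a0 j) * of_int (aseq k a0 (j + 1)))) \<and>
      (\<forall>x\<in>{0..k - 1}. delta k (a0 * x) = b0 \<longleftrightarrow> x = delta k s)"
    if r: "aseq k a0 r = 1" for r
  proof -
    obtain m where m: "r = Suc m"
      using r assms(1) by (cases r) auto
    have ge2: "2 \<le> aseq k a0 i" if "i \<le> m" for i
      using aseq_ge_2_before_1[OF assms(1) r] that m by simp
    have nz: "aseq k a0 i \<noteq> 0" if "i \<le> m" for i
      using ge2[OF that] by linarith
    have a_cong: "[aseq k a0 (i + 2) = aseq k a0 i] (mod aseq k a0 (i + 1))" if "i < m" for i
      using ge2[of "Suc i"] that by (simp add: delta_eq_mod)
    have b_cong: "[bseq k a0 b0 (i + 2) = - bseq k a0 b0 (i + 1)] (mod aseq k a0 (i + 1))" for i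
      by (simp add: delta_eq_mod cong_def mod_simps)
    obtain s where s: "(of_int s :: rat) = of_int (aseq k a0 0) *
        (\<Sum>j<Suc m. of_int (bseq k a0 b0 (j + 1)) / (of_int (aseq k a0 j) * of_int (aseq k a0 (j + 1))))"
      and sol: "[aseq k a0 1 * s = bseq k a0 b0 1] (mod aseq k a0 0)"
      using euclidean_sum_solves_congruence
        [where a = "aseq k a0" and b = "bseq k a0 b0" and r = m and 'a = rat,
          OF r[unfolded m] nz a_cong b_cong] by blast
    have sol: "[a0 * s = b0] (mod k)"
      using sol by simp
    have "delta k (a0 * x) = b0 \<longleftrightarrow> x = delta k s" if x: "x \<in> {0..k - 1}" for x
    proof -
      have "delta k (a0 * x) = b0 \<longleftrightarrow> [a0 * x = b0] (mod k)"
        using assms(5) by (simp add: delta_eq_mod cong_def)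
      also have "\<dots> \<longleftrightarrow> [a0 * x = a0 * s] (mod k)"
        using sol by (simp add: cong_def)
      also have "\<dots> \<longleftrightarrow> [x = s] (mod k)"
        using cop by (rule cong_mult_lcancel)
      also have "\<dots> \<longleftrightarrow> x = delta k s"
        using x by (simp add: delta_eq_mod cong_def)
      finally show ?thesis .
    qed
    then show ?thesis
      using s m by auto
  qed
  obtain r where "aseq k a0 r = 1"
    using ex1 by blast
  then obtain s where "\<forall>x\<in>{0..k - 1}. delta k (a0 * x) = b0 \<longleftrightarrow> x = delta k s"
    using main by blast
  moreover have "delta k s \<in> {0..k - 1}"
    using assms(1) by (simp add: delta_eq_mod)
  ultimately have "\<exists>!x. x \<in> {0..k - 1} \<and> delta k (a0 * x) = b0"
    by (intro ex1I[of _ "delta k s"]) auto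
  with ex1 main show ?thesis
    by blast
qed

end
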